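(* The characteristic polynomials of $BB^T$ for the L-shaped snake graphs are given by the expressions \begin{align*} \chi_{L_{2m,2n}}&=\left[Q_{m+n-1}-Q_{m-1}Q_{n-1}\right]\left[(x-1)Q_{m+n}+P_mP_n\right],\\ \chi_{L_{2m+1,2n+1}}&=\left[(x-1)Q_{m+n}-P_{m}P_{n}\right]\left[Q_{m+n+1}+Q_{m}Q_{n}\right],\\ \chi_{L_{2m,2n+1}}&=\left[P_{m+n}-Q_{m-1}P_{n}\right]\left[P_{m+n+1}+P_{m}Q_{n}\right]. \end{align*}
   Context: A snake graph is a plane graph consisting of a sequence of square tiles, each placed to the right of or on top of the previous one, adjacent tiles sharing exactly one edge. For natural numbers $r,s$, the (mirrored) L-shaped snake graph $L_{r,s}$ is created by placing first $r$ tiles to the right of each other and then $s-1$ tiles on top of each other (so it has one turning tile). The vertices are coloured black/white in the bipartition so that the two turns of the turning tile (its vertex with exactly 2 neighbours and its vertex with exactly 4 neighbours) are black. The graph is equipped with a Kasteleyn weighting $w\colon E\to\{\pm1\}$ (each face which is a $k$-gon, including the infinite face, has an odd number of edges of weight $-1$ if $k\equiv 0 \bmod 4$ and an even number if $k\equiv 2\bmod 4$), and $B$ is the weighted bipartite adjacency matrix (rows indexed by black vertices, columns by white vertices, entry $w(e)$ if joined by edge $e$, else $0$). $\chi_{L_{r,s}}=\chi_{L_{r,s}}(x)$ denotes the characteristic polynomial of $BB^T$ for $G=L_{r,s}$. The Fibonacci product polynomials are defined by $P_0=Q_0=1$ and, for $n\ge1$, $P_n(x)$ is the characteristic polynomial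 of the $n\times n$ tridiagonal matrix with diagonal $(2,3,3,\ldots,3)$ and all sub- and superdiagonal entries $1$, while $Q_n(x)$ is the characteristic polynomial of the $n\times n$ tridiagonal matrix with diagonal $(3,3,\ldots,3)$ and sub- and superdiagonal entries $1$; equivalently $P_{n+1}=(x-3)P_n-P_{n-1}$, $Q_{n+1}=(x-3)Q_n-Q_{n-1}$ with $P_1=x-2$, $Q_1=x-3$. Convention $Q_{-1}=0$. *)

theory Defs
  imports "Jordan_Normal_Form.Char_Poly"
begin

text \<open>Snake graphs are drawn in the integer lattice; the tile \<open>(i, j)\<close> is the unit square whose
  lower left corner is \<open>(i, j)\<close>. An edge is the set of its two endpoints.\<close>

type_synonym vertex = "nat \<times> nat"
type_synonym tile = "nat \<times> nat"

fun tile_vertices :: "tile \<Rightarrow> vertex set" where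
  "tile_vertices (i, j) = {(i, j), (i + 1, j), (i, j + 1), (i + 1, j + 1)}"

fun tile_edges :: "tile \<Rightarrow> vertex set set" where
  "tile_edges (i, j) =
     {{(i, j), (i + 1, j)}, {(i + 1, j), (i + 1, j + 1)},
      {(i, j + 1), (i + 1, j + 1)}, {(i, j), (i, j + 1)}}"

definition is_snake :: "tile list \<Rightarrow> bool" where
  "is_snake ts \<longleftrightarrow> ts \<noteq> [] \<and>
     (\<forall>k. Suc k < length ts \<longrightarrow>
        (case ts ! k of (i, j) \<Rightarrow> ts ! Suc k = (i + 1, j) \<or> ts ! Suc k = (i, j + 1)))"

definition snake_vertices :: "tile list \<Rightarrow> vertex set" where
  "snake_vertices ts = (\<Union>t\<in>set ts. tile_vertices t)"

definition snake_edges :: "tile list \<Rightarrow> vertex set set" where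
  "snake_edges ts = (\<Union>t\<in>set ts. tile_edges t)"

text \<open>A snake graph is 2-connected and its bounded faces are the tiles, so the boundary of the
  infinite face is the cycle formed by the edges that lie on exactly one tile. Faces are
  represented by the sets of their boundary edges. (For a single tile the two faces have the same
  boundary, and hence the same representative.)\<close>

definition outer_face :: "tile list \<Rightarrow> vertex set set" where
  "outer_face ts = {e \<in> snake_edges ts. \<exists>!t. t \<in> set ts \<and> e \<in> tile_edges t}"

definition snake_faces :: "tile list \<Rightarrow> vertex set set set" where
  "snake_faces ts = insert (outer_face ts) (tile_edges ` set ts)"

definition kasteleyn_weighting :: "tile list \<Rightarrow> (vertex set \<Rightarrow> real) \<Rightarrow> bool" where
  "kasteleyn_weighting ts w \<longleftrightarrow>
     (\<forall>e\<in>snake_edges ts. w e \<in> {1, -1}) \<and>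
     (\<forall>F\<in>snake_faces ts.
        (card F mod 4 = 0 \<longrightarrow> odd (card {e \<in> F. w e = -1})) \<and>
        (card F mod 4 = 2 \<longrightarrow> even (card {e \<in> F. w e = -1})))"

definition neighbours :: "tile list \<Rightarrow> vertex \<Rightarrow> vertex set" where
  "neighbours ts v = {u. {u, v} \<in> snake_edges ts}"

definition bipartition :: "tile list \<Rightarrow> vertex set \<Rightarrow> vertex set \<Rightarrow> bool" where
  "bipartition ts Bl Wh \<longleftrightarrow>
     Bl \<union> Wh = snake_vertices ts \<and> Bl \<inter> Wh = {} \<and>
     (\<forall>e\<in>snake_edges ts. \<exists>b\<in>Bl. \<exists>u\<in>Wh. e = {b, u})"

text \<open>\<open>r\<close> tiles to the right of each other, then \<open>s - 1\<close> tiles on top of the last of these, which is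
  the turning tile \<open>(r - 1, 0)\<close>. Meaningful for \<open>r, s \<ge> 1\<close> only.\<close>

definition L_snake :: "nat \<Rightarrow> nat \<Rightarrow> tile list" where
  "L_snake r s = map (\<lambda>i. (i, 0)) [0..<r] @ map (\<lambda>j. (r - 1, j)) [1..<s]"

lemma is_snake_L_snake:
  assumes "1 \<le> r" "1 \<le> s"
  shows "is_snake (L_snake r s)"
  using assms unfolding is_snake_def L_snake_def
  by (auto simp: nth_append)

definition L_turns :: "nat \<Rightarrow> nat \<Rightarrow> vertex set" where
  "L_turns r s = {v \<in> tile_vertices (r - 1, 0).
     card (neighbours (L_snake r s) v) = 2 \<or> card (neighbours (L_snake r s) v) = 4}"

text \<open>If \<open>r = 1\<close> or \<open>s = 1\<close>, the snake is straight and has no turn; either colour class may then be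
  the black one.\<close>

definition L_colouring :: "nat \<Rightarrow> nat \<Rightarrow> vertex set \<Rightarrow> vertex set \<Rightarrow> bool" where
  "L_colouring r s Bl Wh \<longleftrightarrow>
     bipartition (L_snake r s) Bl Wh \<and> (2 \<le> r \<and> 2 \<le> s \<longrightarrow> L_turns r s \<subseteq> Bl)"

text \<open>The lists \<open>bs\<close> and \<open>ws\<close> order the black and the white vertices, that is, the rows and the
  columns of the matrix.\<close>

definition bip_adj_matrix ::
    "tile list \<Rightarrow> (vertex set \<Rightarrow> real) \<Rightarrow> vertex list \<Rightarrow> vertex list \<Rightarrow> real mat" where
  "bip_adj_matrix ts w bs ws = mat (length bs) (length ws)
     (\<lambda>(i, j). if {bs ! i, ws ! j} \<in> snake_edges ts then w {bs ! i, ws ! j} else 0)"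

text \<open>\<open>L_bip_adj r s B\<close>: \<open>B\<close> is a weighted bipartite adjacency matrix of the L-shaped snake graph, for
  some Kasteleyn weighting and some order of the black and of the white vertices. Statements about
  the characteristic polynomial of the graph are made for all such \<open>B\<close>, so that its independence of
  these choices is part of the claim.\<close>

definition L_bip_adj :: "nat \<Rightarrow> nat \<Rightarrow> real mat \<Rightarrow> bool" where
  "L_bip_adj r s B \<longleftrightarrow> (\<exists>w bs ws.
     kasteleyn_weighting (L_snake r s) w \<and>
     distinct bs \<and> distinct ws \<and> L_colouring r s (set bs) (set ws) \<and>
     B = bip_adj_matrix (L_snake r s) w bs ws)"

definition chi :: "real mat \<Rightarrow> real poly" where
  "chi B = char_poly (B * B\<^sup>T)"

definition tridiag :: "nat \<Rightarrow> real \<Rightarrow> real mat" where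
  "tridiag n a = mat n n (\<lambda>(i, j).
     if i = j then (if i = 0 then a else 3)
     else if i = Suc j \<or> j = Suc i then 1 else 0)"

text \<open>For \<open>n = 0\<close> these are determinants of the empty matrix, that is, \<open>1\<close>.\<close>

definition fibP :: "nat \<Rightarrow> real poly" where
  "fibP n = char_poly (tridiag n 2)"

definition fibQ :: "nat \<Rightarrow> real poly" where
  "fibQ n = char_poly (tridiag n 3)"

lemma fibP_0: "fibP 0 = 1" and fibQ_0: "fibQ 0 = 1"
  by (simp_all add: fibP_def fibQ_def tridiag_def char_poly_def char_poly_matrix_def)

end

theory Submission
  imports Defs "HOL-Combinatorics.Permutations"
begin

text \<open>The edge weights around a tile multiply to \<open>-1\<close>, so the two paths of length two between
  opposite corners cancel in \<open>BB\<^sup>T\<close>. What remains are the black vertices at distance two along the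
  outer boundary line of the snake and along the inner one; hence \<open>BB\<^sup>T\<close> is, up to the order of the
  vertices, a direct sum of two tridiagonal matrices with off-diagonal entries \<open>1\<close> or \<open>-1\<close> and with
  the vertex degrees on the diagonal. Their characteristic polynomials satisfy the recurrence of the
  Fibonacci product polynomials, perturbed at the turn, where the degree is \<open>2\<close> on the outer and \<open>4\<close>
  on the inner line. If the outer corner is white, \<open>B\<close> is replaced by its transpose, which does not
  change the characteristic polynomial.\<close>

section \<open>Determinants\<close>

text \<open>Laplace expansion along the last row leaves two terms. In the minor of the entry at
  \<open>(Suc n, n)\<close> the last column is what remains of column \<open>Suc n\<close>, and
  expanding along it leaves a single term.\<close>

lemma det_tridiagonal:
  fixes f :: "nat \<Rightarrow> nat \<Rightarrow> 'a :: comm_ring_1"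
  assumes "\<And>i. i < n \<Longrightarrow> f i (Suc n) = 0" and "\<And>i. i < n \<Longrightarrow> f (Suc n) i = 0"
  shows "det (mat (n + 2) (n + 2) (\<lambda>(i, j). f i j)) =
     f (Suc n) (Suc n) * det (mat (Suc n) (Suc n) (\<lambda>(i, j). f i j)) -
     f (Suc n) n * f n (Suc n) * det (mat n n (\<lambda>(i, j). f i j))"
proof -
  define A where "A = mat (n + 2) (n + 2) (\<lambda>(i, j). f i j)"
  have A: "A \<in> carrier_mat (n + 2) (n + 2)" by (simp add: A_def)
  define C where "C = mat_delete A (Suc n) n"
  have C: "C \<in> carrier_mat (Suc n) (Suc n)"
    unfolding C_def using mat_delete_carrier[OF A] by simp
  have "det A = (\<Sum>j<n+2. A $$ (Suc n, j) * cofactor A (Suc n) j)"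
    by (rule laplace_expansion_row[OF A]) simp
  also have "\<dots> = A $$ (Suc n, n) * cofactor A (Suc n) n +
      A $$ (Suc n, Suc n) * cofactor A (Suc n) (Suc n)"
    using assms(2) by (simp add: A_def)
  also have "cofactor A (Suc n) (Suc n) = det (mat (Suc n) (Suc n) (\<lambda>(i, j). f i j))"
    unfolding cofactor_def
    by (auto simp: mat_delete_def A_def intro!: arg_cong[where f = det])
  also have "cofactor A (Suc n) n = - det C"
    by (simp add: cofactor_def C_def)
  also have "det C = (\<Sum>i<Suc n. C $$ (i, n) * cofactor C i n)"
    by (rule laplace_expansion_column[OF C]) simp
  also have "\<dots> = C $$ (n, n) * cofactor C n n"
    using assms(1) by (simp add: C_def A_def mat_delete_def)
  also have "cofactor C n n = det (mat n n (\<lambda>(i, j). f i j))"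
    unfolding cofactor_def
    by (auto simp: mat_delete_def C_def A_def intro!: arg_cong[where f = det])
  finally show ?thesis by (simp add: A_def C_def mat_delete_def algebra_simps)
qed

text \<open>The continuant: the characteristic polynomial of a symmetric tridiagonal matrix with
  diagonal \<open>d\<close> and off-diagonal entries 1 or -1.\<close>

fun path_poly :: "(nat \<Rightarrow> real) \<Rightarrow> nat \<Rightarrow> real poly" where
  "path_poly d 0 = 1"
| "path_poly d (Suc 0) = [:- d 0, 1:]"
| "path_poly d (Suc (Suc n)) = [:- d (Suc n), 1:] * path_poly d (Suc n) - path_poly d n"

lemma path_poly_cong:
  "(\<And>i. i < n \<Longrightarrow> d i = e i) \<Longrightarrow> path_poly d n = path_poly e n"
  by (induction d n rule: path_poly.induct) auto

text \<open>Off-diagonal entries enter the recurrence only through products of opposite ones, so the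
  signs that a Kasteleyn weighting leaves open disappear here.\<close>

lemma det_path:
  fixes f :: "nat \<Rightarrow> nat \<Rightarrow> real poly"
  assumes "\<And>i. i < n \<Longrightarrow> f i i = [:- d i, 1:]"
    and "\<And>i. Suc i < n \<Longrightarrow> f (Suc i) i * f i (Suc i) = 1"
    and "\<And>i j. i < n \<Longrightarrow> j < n \<Longrightarrow> Suc i < j \<or> Suc j < i \<Longrightarrow> f i j = 0"
  shows "det (mat n n (\<lambda>(i, j). f i j)) = path_poly d n"
  using assms
\<comment> \<open>The induction predicate is made to ignore the first argument of
  \<open>path_poly\<close>: the diagonal stays fixed while \<open>n\<close> varies.\<close>
proof (induction n rule: path_poly.induct[where ?P = "\<lambda>_ n. _ n"])
  case (1 d)
  show ?case by (simp add: det_dim_zero)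
next
  case (2 d)
  then show ?case by (simp add: det_single)
next
  case (3 d n)
  then show ?case using det_tridiagonal[of n f] by simp
qed

text \<open>Rows and columns are permuted by the same \<open>p\<close>, so the two signs cancel.
  This makes \<open>chi\<close> independent of the order of the black vertices.\<close>

lemma det_map_list_perm:
  fixes h :: "'b \<Rightarrow> 'b \<Rightarrow> 'a :: comm_ring_1"
  assumes "distinct bs" "distinct cs" "set bs = set cs"
  shows "det (mat (length bs) (length bs) (\<lambda>(i, j). h (bs ! i) (bs ! j))) =
         det (mat (length cs) (length cs) (\<lambda>(i, j). h (cs ! i) (cs ! j)))"
proof -
  define n where "n = length cs"
  have len: "length bs = n" 
    using assms distinct_card[of bs] distinct_card[of cs] by (simp add: n_def)
  have "mset bs = mset cs" using assms set_eq_iff_mset_eq_distinct by blast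
  then obtain p where p: "p permutes {..<length cs}" "permute_list p cs = bs"
    by (rule mset_eq_permutation)
  have nth: "bs ! i = cs ! p i" if "i < n" for i
    using permute_list_nth[OF p(1), of i] p(2) that by (simp add: n_def)
  have pn: "p permutes {0..<n}" using p(1) by (simp add: n_def atLeast0LessThan)
  have pl: "p i < n" if "i < n" for i
    using permutes_in_image[OF pn, of i] that by simp
  define A where "A = mat n n (\<lambda>(i, j). h (cs ! i) (cs ! j))"
  define A' where "A' = mat n n (\<lambda>(i, j). A $$ (p i, j))"
  have A: "A \<in> carrier_mat n n" "A' \<in> carrier_mat n n" by (auto simp: A_def A'_def)
  \<comment> \<open>Columns are permuted as rows of the transpose, so the lemma on rows serves
    twice.\<close>
  have "mat n n (\<lambda>(i, j). h (bs ! i) (bs ! j)) = (mat n n (\<lambda>(i, j). A'\<^sup>T $$ (p i, j)))\<^sup>T"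
    by (rule eq_matI) (auto simp: A_def A'_def nth pl)
  then have "det (mat n n (\<lambda>(i, j). h (bs ! i) (bs ! j))) = signof p * (signof p * det A)"
    using det_permute_rows[OF A(1) pn] det_permute_rows[OF _ pn, of "A'\<^sup>T"] A
    by (simp add: A'_def[symmetric] det_transpose[of _ n])
  also have "\<dots> = det A"
    by (simp add: sign_def)
  finally show ?thesis by (simp add: A_def len n_def)
qed

text \<open>The matrix is block diagonal; the two factors of \<open>chi\<close> arise from
  this.\<close>

lemma det_append_list:
  fixes h :: "'b \<Rightarrow> 'b \<Rightarrow> 'a :: idom"
  assumes "\<And>u v. u \<in> set us \<Longrightarrow> v \<in> set vs \<Longrightarrow> h u v = 0"
  assumes "\<And>u v. u \<in> set us \<Longrightarrow> v \<in> set vs \<Longrightarrow> h v u = 0"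
  shows "det (mat (length (us @ vs)) (length (us @ vs)) (\<lambda>(i, j). h ((us @ vs) ! i) ((us @ vs) ! j))) =
         det (mat (length us) (length us) (\<lambda>(i, j). h (us ! i) (us ! j))) *
         det (mat (length vs) (length vs) (\<lambda>(i, j). h (vs ! i) (vs ! j)))"
proof -
  have "mat (length (us @ vs)) (length (us @ vs)) (\<lambda>(i, j). h ((us @ vs) ! i) ((us @ vs) ! j)) =
    four_block_mat (mat (length us) (length us) (\<lambda>(i, j). h (us ! i) (us ! j)))
      (0\<^sub>m (length us) (length vs)) (0\<^sub>m (length vs) (length us))
      (mat (length vs) (length vs) (\<lambda>(i, j). h (vs ! i) (vs ! j)))"
    using assms by (intro eq_matI) (auto simp: nth_append)
  then show ?thesis
    by (simp add: det_four_block_mat_upper_right_zero[of _ "length us" _ "length vs"])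
qed

text \<open>Exchanging the block rows and exchanging the block columns each cost a factor
  \<open>(-1) ^ (n * n)\<close>, and these cancel.\<close>

lemma det_four_block_mat_swap:
  fixes A :: "'a :: comm_ring_1 mat"
  assumes "A \<in> carrier_mat n n" "B \<in> carrier_mat n n" "C \<in> carrier_mat n n" "D \<in> carrier_mat n n"
  shows "det (four_block_mat A B C D) = det (four_block_mat D C B A)"
proof -
  define M where "M = four_block_mat A B C D"
  define N where "N = mat (n + n) (n + n) (\<lambda>(i, j). M $$ ((if i < n then i + n else i - n), j))"
  have M: "M \<in> carrier_mat (n + n) (n + n)" using assms by (simp add: M_def)
  have N: "N \<in> carrier_mat (n + n) (n + n)" by (simp add: N_def)
  have "mat (n + n) (n + n) (\<lambda>(i, j). N $$ (i, (if j < n then j + n else j - n))) =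
      four_block_mat D C B A"
    using assms by (intro eq_matI) (auto simp: N_def M_def)
  moreover have "det M = (- 1) ^ (n * n) * ((- 1) ^ (n * n) *
      det (mat (n + n) (n + n) (\<lambda>(i, j). N $$ (i, (if j < n then j + n else j - n)))))"
    using det_swap_rows[OF M] det_swap_cols[OF N] by (simp add: N_def)
  ultimately show ?thesis
    by (simp add: M_def mult.assoc[symmetric] power_add[symmetric] flip: mult_2)
qed

text \<open>With \<open>X\<close> the indeterminate times the identity, the block matrix with rows
  \<open>1, A\<close> and \<open>B, X\<close> has determinant \<open>det (X - A * B)\<close>.
  Swapping the blocks gives rows \<open>X, B\<close> and \<open>A, 1\<close>, with determinant
  \<open>det (X - B * A)\<close>. In both matrices the lower blocks commute, as one of them is
  scalar.\<close>

lemma char_poly_mult_commute: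
  fixes A :: "'a :: idom mat"
  assumes A: "A \<in> carrier_mat n n" and B: "B \<in> carrier_mat n n"
  shows "char_poly (A * B) = char_poly (B * A)"
proof -
  let ?A = "map_mat (\<lambda>a. [:a:]) A" and ?B = "map_mat (\<lambda>a. [:a:]) B"
  let ?X = "[:0, 1:] \<cdot>\<^sub>m 1\<^sub>m n :: 'a poly mat"
  interpret semiring_hom "\<lambda>a :: 'a. [:a:]" by unfold_locales auto
  have cp: "char_poly (U * V) = det (1\<^sub>m n * ?X - map_mat (\<lambda>a. [:a:]) U * map_mat (\<lambda>a. [:a:]) V)"
    if "U \<in> carrier_mat n n" "V \<in> carrier_mat n n" for U V :: "'a mat"
    unfolding char_poly_defs using that
    by (intro arg_cong[where f = det]) (auto simp: mat_hom_mult[symmetric, of _ n n _ n])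
  have "char_poly (A * B) = det (four_block_mat (1\<^sub>m n) ?A ?B ?X)"
    using A B by (subst det_four_block_mat[of _ n]) (auto simp: cp)
  also have "\<dots> = det (four_block_mat ?X ?B ?A (1\<^sub>m n))"
    using A B by (intro det_four_block_mat_swap) auto
  also have "\<dots> = char_poly (B * A)"
    using A B by (subst det_four_block_mat[of _ n]) (auto simp: cp)
  finally show ?thesis .
qed

section \<open>Characteristic polynomials of paths\<close>

lemma char_poly_tridiag: "char_poly (tridiag n a) = path_poly (\<lambda>i. if i = 0 then a else 3) n"
proof -
  define f :: "nat \<Rightarrow> nat \<Rightarrow> real poly" where
    "f i j = (if i = j then [:- (if i = 0 then a else 3), 1:]
       else if i = Suc j \<or> j = Suc i then -1 else 0)" for i j
  have "char_poly_matrix (tridiag n a) = mat n n (\<lambda>(i, j). f i j)"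
    by (intro eq_matI) (auto simp: char_poly_matrix_def tridiag_def f_def one_pCons)
  then show ?thesis
    unfolding char_poly_def by (simp, intro det_path) (auto simp: f_def)
qed

lemma fibP_eq_path_poly: "fibP = path_poly (\<lambda>i. if i = 0 then 2 else 3)"
  by (intro ext) (simp add: fibP_def char_poly_tridiag)

lemma fibQ_eq_path_poly: "fibQ = path_poly (\<lambda>i. 3)"
proof
  show "fibQ n = path_poly (\<lambda>i. 3) n" for n
    unfolding fibQ_def char_poly_tridiag by (rule path_poly_cong) simp
qed

section \<open>Recurrences and linear relations of the Fibonacci product polynomials\<close>

lemma fibQ_simps [simp]:
  "fibQ 0 = 1" "fibQ (Suc 0) = [:-3, 1:]"
  "fibQ (Suc (Suc n)) = [:-3, 1:] * fibQ (Suc n) - fibQ n"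
  by (simp_all add: fibQ_eq_path_poly)

lemma fibP_simps [simp]:
  "fibP 0 = 1" "fibP (Suc 0) = [:-2, 1:]"
  "fibP (Suc (Suc n)) = [:-3, 1:] * fibP (Suc n) - fibP n"
  by (simp_all add: fibP_eq_path_poly)

text \<open>Both sides satisfy the same recurrence. Starting at \<open>Suc n\<close> avoids the
  convention that \<open>fibQ\<close> vanishes at index -1.\<close>

lemma fibP_Suc: "fibP (Suc n) = fibQ (Suc n) + fibQ n"
proof (induction n rule: induct_nat_012)
  case (ge2 n)
  have "fibP (Suc (Suc (Suc n))) = [:-3, 1:] * fibP (Suc (Suc n)) - fibP (Suc n)"
    by (rule fibP_simps)
  also have "\<dots> = ([:-3, 1:] * fibQ (Suc (Suc n)) - fibQ (Suc n)) + ([:-3, 1:] * fibQ (Suc n) - fibQ n)"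
    unfolding ge2 by (simp only: algebra_simps)
  also have "\<dots> = fibQ (Suc (Suc (Suc n))) + fibQ (Suc (Suc n))"
    by (simp only: fibQ_simps(3))
  finally show ?case .
qed (simp_all add: one_pCons)

text \<open>Again both sides satisfy the same recurrence. The left-hand side is the polynomial of a
  path on \<open>Suc n\<close> vertices with both end entries lowered by one.\<close>

lemma fibP_Suc_add: "fibP (Suc n) + fibP n = [:-1, 1:] * fibQ n"
proof (induction n rule: induct_nat_012)
  case (ge2 n)
  have "fibP (Suc (Suc (Suc n))) + fibP (Suc (Suc n)) =
      [:-3, 1:] * (fibP (Suc (Suc n)) + fibP (Suc n)) - (fibP (Suc n) + fibP n)"
    unfolding distrib_left fibP_simps(3)[of "Suc n"]
    by (subst (2) fibP_simps(3)) (simp only: algebra_simps)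
  also have "\<dots> = [:-1, 1:] * ([:-3, 1:] * fibQ (Suc n) - fibQ n)"
    unfolding ge2 by (simp only: right_diff_distrib mult.left_commute)
  finally show ?case by (simp only: fibQ_simps(3))
qed (simp_all add: one_pCons)

text \<open>Linearity of the determinant in the diagonal entry at \<open>m\<close>: the coefficient
  of \<open>\<delta>\<close> is minus the product of the polynomials of the two paths, on
  \<open>m\<close> and \<open>n\<close> vertices, left after removing that vertex. A free
  \<open>e\<close> lets \<open>X\<close> be \<open>fibP\<close> or \<open>fibQ\<close>.\<close>

lemma path_poly_centre:
  fixes e \<delta> :: real and m n :: nat
  defines "X \<equiv> path_poly (\<lambda>i. if i = 0 then e else 3)"
  defines "d \<equiv> \<lambda>i. (if i = 0 then e else 3) + \<delta> * of_bool (i = m)"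
  shows "path_poly d (m + Suc n) = X (m + Suc n) - Polynomial.smult \<delta> (X m * fibQ n)"
proof -
  have X: "path_poly d k = X k" if "k \<le> m" for k
    unfolding X_def d_def using that by (intro path_poly_cong) simp
  have 0: "path_poly d (Suc m) = X (Suc m) - Polynomial.smult \<delta> (X m)"
  proof (cases m)
    case 0
    then show ?thesis by (simp add: X_def d_def one_pCons)
  next
    case (Suc k)
    have "path_poly d (Suc m) = [:- (3 + \<delta>), 1:] * path_poly d m - path_poly d k"
      by (simp add: Suc d_def)
    also have "[:- (3 + \<delta>), 1:] = [:-3, 1:] - [:\<delta>:]" by simp
    also have "([:-3, 1:] - [:\<delta>:]) * path_poly d m - path_poly d k =
        X (Suc m) - Polynomial.smult \<delta> (X m)"
      using X[of m] X[of k] by (simp add: Suc X_def left_diff_distrib Polynomial.smult_diff_left)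
    finally show ?thesis .
  qed
  show ?thesis
  proof (induction n rule: induct_nat_012)
    case 0
    show ?case using \<open>path_poly d (Suc m) = _\<close> by simp
  next
    case 1
    have "path_poly d (Suc (Suc m)) = [:-3, 1:] * path_poly d (Suc m) - path_poly d m"
      by (simp add: d_def)
    also have "\<dots> = X (Suc (Suc m)) - Polynomial.smult \<delta> (X m * [:-3, 1:])"
      using X[of m] by (simp add: 0 X_def algebra_simps)
    finally show ?case by simp
  next
    case (ge2 n)
    have "path_poly d (m + Suc (Suc (Suc n))) =
        [:-3, 1:] * path_poly d (m + Suc (Suc n)) - path_poly d (m + Suc n)"
      by (simp add: d_def)
    also have "\<dots> = X (m + Suc (Suc (Suc n))) - Polynomial.smult \<delta> (X m * fibQ (Suc (Suc n)))"
      unfolding ge2 by (simp add: X_def algebra_simps Polynomial.smult_diff_right Polynomial.smult_add_right)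
    finally show ?case .
  qed
qed

text \<open>Linearity in the last diagonal entry; the extra term belongs to the path without its
  last vertex.\<close>

lemma path_poly_end:
  "path_poly (\<lambda>i. d i - of_bool (i = n)) (Suc n) = path_poly d (Suc n) + path_poly d n"
proof (cases n)
  case (Suc k)
  have "path_poly (\<lambda>i. d i - of_bool (i = n)) l = path_poly d l" if "l \<le> n" for l
    using that by (intro path_poly_cong) simp
  moreover have "[:- (d n - 1), 1:] = [:- d n, 1:] + 1" by (simp add: one_pCons)
  ultimately show ?thesis
    using Suc by (simp add: distrib_right)
qed (simp add: one_pCons)

text \<open>By \<open>path_poly_end\<close>, the arm after the turn now contributes
  \<open>fibQ n + fibQ (n - 1)\<close>, which is \<open>fibP n\<close> by
  \<open>fibP_Suc\<close>.\<close>

lemma path_poly_centre_end: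
  fixes e \<delta> :: real and m n :: nat
  defines "X \<equiv> path_poly (\<lambda>i. if i = 0 then e else 3)"
  defines "d \<equiv> \<lambda>i. (if i = 0 then e else 3) + \<delta> * of_bool (i = m)"
  shows "path_poly (\<lambda>i. d i - of_bool (i = m + n)) (m + Suc n) =
    X (m + Suc n) + X (m + n) - Polynomial.smult \<delta> (X m * fibP n)"
proof -
  have E: "path_poly (\<lambda>i. d i - of_bool (i = m + n)) (m + Suc n) =
      path_poly d (m + Suc n) + path_poly d (m + n)"
    using path_poly_end[of d "m + n"] by simp
  show ?thesis
  proof (cases n)
    \<comment> \<open>The turn is itself the last vertex, and \<open>fibP 0 = 1\<close> stands for
      the empty arm.\<close>
    case 0
    have "path_poly d m = X m"
      unfolding X_def d_def by (intro path_poly_cong) simp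
    then show ?thesis
      using E path_poly_centre[of e \<delta> m 0] by (simp add: 0 X_def d_def)
  next
    case (Suc k)
    show ?thesis
      unfolding E unfolding X_def d_def Suc path_poly_centre fibP_Suc
      by (simp add: algebra_simps Polynomial.smult_add_right del: fibQ_simps path_poly.simps)
  qed
qed

text \<open>The vertex degrees along one of the two paths of black vertices: \<open>m\<close> vertices before the turn,
  the turn itself (of degree \<open>3 + \<delta>\<close>) and \<open>n\<close> vertices after it. The flags tell whether the
  first and the last vertex lie on an end of the snake and so have one neighbour less. With \<open>m = 0\<close>
  or \<open>n = 0\<close> the corrections accumulate, which covers the straight snakes.\<close>

definition two_arm_diag :: "real \<Rightarrow> bool \<Rightarrow> bool \<Rightarrow> nat \<Rightarrow> nat \<Rightarrow> nat \<Rightarrow> real" where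
  "two_arm_diag \<delta> a b m n k =
     3 + \<delta> * of_bool (k = m) - of_bool (k = 0 \<and> a) - of_bool (k = m + n \<and> b)"

text \<open>The first flag chooses \<open>e = 2\<close> instead of \<open>e = 3\<close>, the second
  calls for \<open>path_poly_centre_end\<close>. The leading terms then come from
  \<open>fibP_Suc\<close> in the third case and from \<open>fibP_Suc_add\<close>, the source of the
  factor \<open>[:-1, 1:]\<close>, in the fourth.\<close>

lemma path_poly_two_arm:
  "path_poly (two_arm_diag \<delta> False False m n) (m + Suc n) =
     fibQ (m + Suc n) - Polynomial.smult \<delta> (fibQ m * fibQ n)"
  "path_poly (two_arm_diag \<delta> True False m n) (m + Suc n) =
     fibP (m + Suc n) - Polynomial.smult \<delta> (fibP m * fibQ n)"
  "path_poly (two_arm_diag \<delta> False True m n) (m + Suc n) =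
     fibP (m + Suc n) - Polynomial.smult \<delta> (fibQ m * fibP n)"
  "path_poly (two_arm_diag \<delta> True True m n) (m + Suc n) =
     [:-1, 1:] * fibQ (m + n) - Polynomial.smult \<delta> (fibP m * fibP n)"
proof -
  have cong: "path_poly d k = path_poly e k" if "\<And>i. d i = e i" for d e k
    using that by presburger
  show "path_poly (two_arm_diag \<delta> False False m n) (m + Suc n) =
     fibQ (m + Suc n) - Polynomial.smult \<delta> (fibQ m * fibQ n)"
    using path_poly_centre[of 3 \<delta> m n]
    by (simp add: fibQ_eq_path_poly two_arm_diag_def[abs_def])
  show "path_poly (two_arm_diag \<delta> True False m n) (m + Suc n) =
     fibP (m + Suc n) - Polynomial.smult \<delta> (fibP m * fibQ n)"
    unfolding fibP_eq_path_poly path_poly_centre[symmetric]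
    by (rule cong) (auto simp: two_arm_diag_def)
  show "path_poly (two_arm_diag \<delta> False True m n) (m + Suc n) =
     fibP (m + Suc n) - Polynomial.smult \<delta> (fibQ m * fibP n)"
    using path_poly_centre_end[of 3 \<delta> m n] fibP_Suc[of "m + n"]
    by (simp add: fibQ_eq_path_poly two_arm_diag_def[abs_def] del: fibP_simps)
  have "path_poly (two_arm_diag \<delta> True True m n) (m + Suc n) =
     fibP (m + Suc n) + fibP (m + n) - Polynomial.smult \<delta> (fibP m * fibP n)"
    unfolding fibP_eq_path_poly path_poly_centre_end[symmetric, unfolded fibP_eq_path_poly]
    by (rule cong) (auto simp: two_arm_diag_def)
  then show "path_poly (two_arm_diag \<delta> True True m n) (m + Suc n) =
     [:-1, 1:] * fibQ (m + n) - Polynomial.smult \<delta> (fibP m * fibP n)"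
    using fibP_Suc_add[of "m + n"] by simp
qed

section \<open>The edges of an L-shaped snake\<close>

text \<open>\<open>outer p\<close> and \<open>inner p\<close> number the two boundary lines of the snake with \<open>Suc p\<close> horizontal tiles
  from its left end to its upper end. They turn at the indices \<open>Suc p\<close> and \<open>p\<close>, so the vertices joined
  by a rung have equal indices before the turn and indices that differ by two after it.\<close>

definition outer :: "nat \<Rightarrow> nat \<Rightarrow> vertex" where
  "outer p i = (min i (Suc p), i - Suc p)"

definition inner :: "nat \<Rightarrow> nat \<Rightarrow> vertex" where
  "inner p i = (min i p, Suc (i - p))"

lemma outer_eq_iff [simp]: "outer p i = outer p j \<longleftrightarrow> i = j"
  by (auto simp: outer_def min_def split: if_splits)

lemma inner_eq_iff [simp]: "inner p i = inner p j \<longleftrightarrow> i = j"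
  by (auto simp: inner_def min_def split: if_splits)

lemma outer_neq_inner [simp]: "outer p i \<noteq> inner p j" "inner p j \<noteq> outer p i"
  by (auto simp: inner_def outer_def min_def split: if_splits)

lemma tile_edges_horizontal:
  "i < p \<Longrightarrow> tile_edges (i, 0) =
     {{outer p i, outer p (Suc i)}, {outer p (Suc i), inner p (Suc i)},
      {inner p i, inner p (Suc i)}, {outer p i, inner p i}}"
  by (simp add: outer_def inner_def)

text \<open>Three corners of this tile are on the outer line and one on the inner line, so the index
  shift along rungs changes here from zero to two.\<close>

lemma tile_edges_turning:
  "tile_edges (p, 0) =
     {{outer p p, outer p (Suc p)}, {outer p (Suc p), outer p (Suc (Suc p))},
      {inner p p, outer p (Suc (Suc p))}, {outer p p, inner p p}}"
  by (simp add: outer_def inner_def)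

lemma tile_edges_vertical:
  "tile_edges (p, Suc j) =
     {{inner p (p + j), outer p (p + j + 2)}, {outer p (p + j + 2), outer p (Suc (p + j + 2))},
      {inner p (Suc (p + j)), outer p (Suc (p + j) + 2)}, {inner p (p + j), inner p (Suc (p + j))}}"
  by (simp add: outer_def inner_def)

lemma set_L_snake:
  "set (L_snake (Suc p) (Suc q)) =
     (\<lambda>i. (i, 0)) ` {..<p} \<union> {(p, 0)} \<union> (\<lambda>j. (p, Suc j)) ` {..<q}"
proof -
  have "{1..<Suc q} = Suc ` {..<q}"
    using image_Suc_lessThan[of q] by auto
  then have "(\<lambda>j. (p, j)) ` {1..<Suc q} = (\<lambda>j. (p, Suc j)) ` {..<q}"
    by (simp only: image_image)
  moreover have "{0..<Suc p} = insert p {..<p}" by auto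
  ultimately show ?thesis by (simp only: L_snake_def set_append set_map set_upt) auto
qed

text \<open>The last two families are the rungs up to the turn and from the turn on. The inner
  corner \<open>inner p p\<close> is on a rung of each, the outer corner
  \<open>outer p (Suc p)\<close> on none.\<close>

lemma snake_edges_L_snake:
  "snake_edges (L_snake (Suc p) (Suc q)) =
     {{outer p i, outer p (Suc i)} | i. i < p + q + 2} \<union>
     {{inner p i, inner p (Suc i)} | i. i < p + q} \<union>
     {{outer p i, inner p i} | i. i \<le> p} \<union>
     {{inner p i, outer p (i + 2)} | i. p \<le> i \<and> i \<le> p + q}" (is "?E = ?R")
proof
  have R1: "{outer p i, outer p (Suc i)} \<in> ?R" if "i < p + q + 2" for i
    by (rule UnI1, rule UnI1, rule UnI1, rule CollectI, rule exI[of _ i]) (use that in simp)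
  have R2: "{inner p i, inner p (Suc i)} \<in> ?R" if "i < p + q" for i
    by (rule UnI1, rule UnI1, rule UnI2, rule CollectI, rule exI[of _ i]) (use that in simp)
  have R3: "{outer p i, inner p i} \<in> ?R" if "i \<le> p" for i
    by (rule UnI1, rule UnI2, rule CollectI, rule exI[of _ i]) (use that in simp)
  have R4: "{inner p i, outer p (i + 2)} \<in> ?R" if "p \<le> i \<and> i \<le> p + q" for i
    by (rule UnI2, rule CollectI, rule exI[of _ i]) (use that in simp)
  have sub1: "tile_edges (i, 0) \<subseteq> ?R" if "i < p" for i
    unfolding tile_edges_horizontal[OF that] insert_subset
    using that by (intro conjI R1 R2 R3 R4 empty_subsetI) simp_all
  have sub2: "tile_edges (p, 0) \<subseteq> ?R"
    unfolding tile_edges_turning insert_subset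
    using R4[of p] by (intro conjI R1 R3 empty_subsetI) simp_all
  have sub3: "tile_edges (p, Suc j) \<subseteq> ?R" if "j < q" for j
    unfolding tile_edges_vertical insert_subset
    using that by (intro conjI R1 R2 R3 R4 empty_subsetI) simp_all
  have "?E = (\<Union>i\<in>{..<p}. tile_edges (i, 0)) \<union> tile_edges (p, 0) \<union>
      (\<Union>j\<in>{..<q}. tile_edges (p, Suc j))"
    unfolding snake_edges_def set_L_snake by auto
  then show "?E \<subseteq> ?R"
    by (elim ssubst) (intro Un_least UN_least sub1 sub2 sub3; simp)
next
  have horizontal: "e \<in> ?E" if "i < p" "e \<in> tile_edges (i, 0)" for e i
    using that unfolding snake_edges_def set_L_snake by blast
  have turning: "e \<in> ?E" if "e \<in> tile_edges (p, 0)" for e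
    using that unfolding snake_edges_def set_L_snake by blast
  have vertical: "e \<in> ?E" if "j < q" "e \<in> tile_edges (p, Suc j)" for e j
    using that unfolding snake_edges_def set_L_snake by blast
  have E1: "{outer p i, outer p (Suc i)} \<in> ?E" if "i < p + q + 2" for i
  proof -
    \<comment> \<open>Both steps at the outer corner, from \<open>p\<close> and from
      \<open>Suc p\<close>, lie on the turning tile.\<close>
    have "i < p \<or> i = p \<or> i = Suc p \<or> (\<exists>j<q. i = p + j + 2)"
      using that by presburger
    then consider "i < p" | "i = p" | "i = Suc p" | j where "j < q" "i = p + j + 2"
      by blast
    then show ?thesis
    proof cases
      case 1
      show ?thesis
        by (rule horizontal[OF 1]) (simp only: tile_edges_horizontal[OF 1] insert_iff simp_thms)
    next
      case 2
      show ?thesis by (rule turning) (simp only: 2 tile_edges_turning insert_iff simp_thms)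
    next
      case 3
      show ?thesis by (rule turning) (simp only: 3 tile_edges_turning insert_iff simp_thms)
    next
      case 4
      show ?thesis by (rule vertical[OF 4(1)]) (simp only: 4 tile_edges_vertical insert_iff simp_thms)
    qed
  qed
  have E2: "{inner p i, inner p (Suc i)} \<in> ?E" if "i < p + q" for i
  proof (cases "i < p")
    case True
    show ?thesis
      by (rule horizontal[OF True]) (simp only: tile_edges_horizontal[OF True] insert_iff simp_thms)
  next
    case False
    then have "\<exists>j<q. i = p + j" using that by presburger
    then obtain j where j: "i = p + j" "j < q" by blast
    show ?thesis by (rule vertical[OF j(2)]) (simp only: j tile_edges_vertical insert_iff simp_thms)
  qed
  have E3: "{outer p i, inner p i} \<in> ?E" if "i \<le> p" for i
  proof (cases "i < p")
    case True
    show ?thesis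
      by (rule horizontal[OF True]) (simp only: tile_edges_horizontal[OF True] insert_iff simp_thms)
  next
    case False
    then have i: "i = p" using that by simp
    show ?thesis by (rule turning) (simp only: i tile_edges_turning insert_iff simp_thms)
  qed
  have E4: "{inner p i, outer p (i + 2)} \<in> ?E" if "p \<le> i" "i \<le> p + q" for i
  proof (cases "i = p")
    case True
    show ?thesis by (rule turning) (simp add: True tile_edges_turning del: tile_edges.simps)
  next
    case False
    then have "\<exists>j<q. i = Suc (p + j)" using that by presburger
    then obtain j where j: "i = Suc (p + j)" "j < q" by blast
    show ?thesis by (rule vertical[OF j(2)]) (simp only: j tile_edges_vertical insert_iff simp_thms)
  qed
  show "?R \<subseteq> ?E"
    by (intro Un_least subsetI; elim CollectE exE conjE; simp only: E1 E2 E3 E4)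
qed

section \<open>Vertices, neighbourhoods and the sign of a tile\<close>

lemma finite_snake_vertices: "finite (snake_vertices ts)"
  by (auto simp: snake_vertices_def)

lemma snake_vertices_eq_Union_edges: "snake_vertices ts = \<Union> (snake_edges ts)"
proof -
  have "tile_vertices t = \<Union> (tile_edges t)" for t by (cases t) auto
  then show ?thesis by (auto simp: snake_vertices_def snake_edges_def)
qed

lemma snake_vertices_L_snake:
  "snake_vertices (L_snake (Suc p) (Suc q)) = outer p ` {..p + q + 2} \<union> inner p ` {..p + q}"
    (is "?V = ?R")
proof
  show "?V \<subseteq> ?R"
    unfolding snake_vertices_eq_Union_edges snake_edges_L_snake by auto
  have E: "u \<in> ?V" if "{u, v} \<in> snake_edges (L_snake (Suc p) (Suc q)) \<or> {v, u} \<in> snake_edges (L_snake (Suc p) (Suc q))" for u v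
    using that unfolding snake_vertices_eq_Union_edges by blast
  have "outer p i \<in> ?V" if "i \<le> p + q + 2" for i
  proof (cases "i < p + q + 2")
    case True
    then show ?thesis by (intro E[of _ "outer p (Suc i)"]) (auto simp: snake_edges_L_snake)
  next
    case False
    then have "i = Suc (p + q + 1)" using that by simp
    then show ?thesis by (intro E[of _ "outer p (p + q + 1)"]) (auto simp: snake_edges_L_snake)
  qed
  moreover have "inner p i \<in> ?V" if "i \<le> p + q" for i
  proof (cases "i \<le> p")
    case True
    then show ?thesis by (intro E[of _ "outer p i"]) (auto simp: snake_edges_L_snake)
  next
    case False
    then show ?thesis using that by (intro E[of _ "outer p (i + 2)"]) (auto simp: snake_edges_L_snake)
  qed
  ultimately show "?R \<subseteq> ?V" by auto
qed

text \<open>Writing neighbourhoods as images of index sets turns common neighbours into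
  intersections of sets of numbers.\<close>

lemma outer_edge_iff:
  assumes "i \<le> p + q + 2"
  shows "{outer p i, u} \<in> snake_edges (L_snake (Suc p) (Suc q)) \<longleftrightarrow>
    u \<in> outer p ` {j. j \<le> p + q + 2 \<and> (j = Suc i \<or> i = Suc j)} \<union>
        inner p ` {j. j \<le> p + q \<and> (j = i \<and> i \<le> p \<or> i = j + 2 \<and> p \<le> j)}" (is "?l \<longleftrightarrow> ?r")
proof
  assume ?l
  then show ?r
    unfolding snake_edges_L_snake Un_iff mem_Collect_eq doubleton_eq_iff
    using assms by (elim disjE exE conjE) simp_all
next
  assume ?r
  then show ?l
    unfolding snake_edges_L_snake Un_iff mem_Collect_eq doubleton_eq_iff
    using assms by (elim UnE imageE CollectE conjE disjE) (simp_all, auto)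
qed

lemma inner_edge_iff:
  assumes "i \<le> p + q"
  shows "{inner p i, u} \<in> snake_edges (L_snake (Suc p) (Suc q)) \<longleftrightarrow>
    u \<in> outer p ` {j. j \<le> p + q + 2 \<and> (j = i \<and> i \<le> p \<or> j = i + 2 \<and> p \<le> i)} \<union>
        inner p ` {j. j \<le> p + q \<and> (j = Suc i \<or> i = Suc j)}" (is "?l \<longleftrightarrow> ?r")
proof
  assume ?l
  then show ?r
    unfolding snake_edges_L_snake Un_iff mem_Collect_eq doubleton_eq_iff
    using assms by (elim disjE exE conjE) simp_all
next
  assume ?r
  then show ?l
    unfolding snake_edges_L_snake Un_iff mem_Collect_eq doubleton_eq_iff
    using assms by (elim UnE imageE CollectE conjE disjE) (simp_all, auto)
qed

text \<open>A tile is a face with four edges, so an odd number of them have weight -1.\<close>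

lemma kasteleyn_weighting_tile:
  assumes "kasteleyn_weighting ts w" "t \<in> set ts"
  shows "prod w (tile_edges t) = -1"
proof -
  obtain i j where t: "t = (i, j)" by (cases t)
  have 4: "card (tile_edges t) = 4"
    by (auto simp: t doubleton_eq_iff card_insert_if)
  have fin: "finite (tile_edges t)" by (simp add: t)
  have face: "tile_edges t \<in> snake_faces ts" using assms(2) by (auto simp: snake_faces_def)
  then have odd: "odd (card {e \<in> tile_edges t. w e = -1})"
    using assms(1) 4 by (auto simp: kasteleyn_weighting_def)
  have "w e = 1 \<or> w e = -1" if "e \<in> tile_edges t" for e
    using conjunct1[OF assms(1)[unfolded kasteleyn_weighting_def]] assms(2) that
    by (auto simp: snake_edges_def)
  then have "prod w (tile_edges t) = (\<Prod>e\<in>tile_edges t. if w e = -1 then -1 else 1)"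
    by (intro prod.cong) auto
  also have "\<dots> = (-1) ^ card {e \<in> tile_edges t. w e = -1}"
    using fin by (simp add: prod.If_cases Int_def conj_commute)
  finally show ?thesis using odd by simp
qed

section \<open>The entries of the Gram matrix\<close>

locale L_weighting =
  fixes p q :: nat and w :: "vertex set \<Rightarrow> real"
  assumes kasteleyn: "kasteleyn_weighting (L_snake (Suc p) (Suc q)) w"
begin

abbreviation E where "E \<equiv> snake_edges (L_snake (Suc p) (Suc q))"
abbreviation V where "V \<equiv> snake_vertices (L_snake (Suc p) (Suc q))"

definition weight :: "vertex \<Rightarrow> vertex \<Rightarrow> real" where
  "weight u v = (if {u, v} \<in> E then w {u, v} else 0)"

text \<open>An entry of BB^T, indexed by vertices. Summing over all of \<open>V\<close> frees it
  from the bipartition and the orders; for black \<open>b\<close> the black \<open>u\<close>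
  contribute nothing.\<close>

definition gram :: "vertex \<Rightarrow> vertex \<Rightarrow> real" where
  "gram b c = (\<Sum>u\<in>V. weight b u * weight c u)"

lemma weight_sign: "e \<in> E \<Longrightarrow> w e = 1 \<or> w e = -1"
  using conjunct1[OF kasteleyn[unfolded kasteleyn_weighting_def]] by simp

lemma gram_commute: "gram b c = gram c b"
  by (simp add: gram_def mult.commute)

text \<open>Only common neighbours contribute, and they correspond to intersections of index sets
  because \<open>outer p\<close> and \<open>inner p\<close> are injective with disjoint
  ranges.\<close>

lemma gram_eq:
  assumes "\<And>u. {b, u} \<in> E \<longleftrightarrow> u \<in> outer p ` A \<union> inner p ` B"
    and "\<And>u. {c, u} \<in> E \<longleftrightarrow> u \<in> outer p ` A' \<union> inner p ` B'"
  shows "gram b c = (\<Sum>j\<in>A \<inter> A'. w {b, outer p j} * w {c, outer p j}) +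
     (\<Sum>j\<in>B \<inter> B'. w {b, inner p j} * w {c, inner p j})"
proof -
  let ?S = "outer p ` (A \<inter> A') \<union> inner p ` (B \<inter> B')"
  have S: "u \<in> ?S \<longleftrightarrow> {b, u} \<in> E \<and> {c, u} \<in> E" for u
    unfolding assms by auto
  have sub: "?S \<subseteq> V"
    unfolding snake_vertices_eq_Union_edges using S by blast
  then have fin: "finite ?S" using finite_snake_vertices finite_subset by blast
  have "gram b c = (\<Sum>u\<in>?S. weight b u * weight c u)"
    unfolding gram_def using S
    by (intro sum.mono_neutral_right finite_snake_vertices sub) (auto simp: weight_def)
  also have "\<dots> = (\<Sum>u\<in>?S. w {b, u} * w {c, u})"
    using S by (intro sum.cong refl) (auto simp: weight_def)
  also have "\<dots> = (\<Sum>u\<in>outer p ` (A \<inter> A'). w {b, u} * w {c, u}) +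
      (\<Sum>u\<in>inner p ` (B \<inter> B'). w {b, u} * w {c, u})"
    using fin by (intro sum.union_disjoint) auto
  finally show ?thesis by (simp add: sum.reindex inj_on_def)
qed

lemmas gram_outer_outer = gram_eq[OF outer_edge_iff outer_edge_iff]
lemmas gram_inner_inner = gram_eq[OF inner_edge_iff inner_edge_iff]
lemmas gram_outer_inner = gram_eq[OF outer_edge_iff inner_edge_iff]

text \<open>Weights square to 1, so a diagonal entry is the degree of its vertex.\<close>

lemma gram_self:
  assumes "\<And>u. {b, u} \<in> E \<longleftrightarrow> u \<in> outer p ` A \<union> inner p ` B"
  shows "gram b b = card A + card B"
proof -
  have "w {b, u} * w {b, u} = 1" if "u \<in> outer p ` A \<union> inner p ` B" for u
    using weight_sign[of "{b, u}"] assms[of u] that by auto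
  then show ?thesis unfolding gram_eq[OF assms assms] by simp
qed

text \<open>Two neighbours along the line and one rung, except that the corner has no rung and each
  end lacks a neighbour on the line.\<close>

lemma gram_outer_self:
  assumes "i \<le> p + q + 2"
  shows "gram (outer p i) (outer p i) =
    3 - of_bool (i = Suc p) - of_bool (i = 0) - of_bool (i = p + q + 2)"
proof -
  have A: "{j. j \<le> p + q + 2 \<and> (j = Suc i \<or> i = Suc j)} =
      (if i = p + q + 2 then {} else {Suc i}) \<union> (if i = 0 then {} else {i - 1})"
    using assms by auto
  have B: "{j. j \<le> p + q \<and> (j = i \<and> i \<le> p \<or> i = j + 2 \<and> p \<le> j)} =
      (if i = Suc p then {} else if i \<le> p then {i} else {i - 2})"
    using assms by auto
  \<comment> \<open>Predecessor and successor on the line are distinct, so the cardinality counts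
    both.\<close>
  have "k - Suc 0 \<noteq> Suc k" for k :: nat by simp
  then show ?thesis
    unfolding gram_self[OF outer_edge_iff[OF assms]] A B by (auto simp: card_insert_if)
qed

text \<open>As on the outer line, except that the corner has two rungs.\<close>

lemma gram_inner_self:
  assumes "i \<le> p + q"
  shows "gram (inner p i) (inner p i) =
    3 + of_bool (i = p) - of_bool (i = 0) - of_bool (i = p + q)"
proof -
  have A: "{j. j \<le> p + q \<and> (j = Suc i \<or> i = Suc j)} =
      (if i = p + q then {} else {Suc i}) \<union> (if i = 0 then {} else {i - 1})"
    using assms by auto
  have B: "{j. j \<le> p + q + 2 \<and> (j = i \<and> i \<le> p \<or> j = i + 2 \<and> p \<le> i)} =
      (if i \<le> p then {i} else {}) \<union> (if p \<le> i then {i + 2} else {})"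
    using assms by auto
  have "k - Suc 0 \<noteq> Suc k" for k :: nat by simp
  then show ?thesis
    unfolding gram_self[OF inner_edge_iff[OF assms]] A B by (auto simp: card_insert_if)
qed

text \<open>The only common neighbour is the vertex in between. Parity excludes
  \<open>i = p\<close>, where \<open>outer p p\<close> and \<open>outer p (p + 2)\<close> also share
  \<open>inner p p\<close>.\<close>

lemma gram_outer_next:
  assumes "i \<le> p + q" "even i \<longleftrightarrow> odd p"
  shows "gram (outer p i) (outer p (i + 2)) = 1 \<or> gram (outer p i) (outer p (i + 2)) = -1"
proof -
  have i: "i \<le> p + q + 2" "i + 2 \<le> p + q + 2" using assms by auto
  have "{j. j \<le> p + q + 2 \<and> (j = Suc i \<or> i = Suc j)} \<inter>
        {j. j \<le> p + q + 2 \<and> (j = Suc (i + 2) \<or> i + 2 = Suc j)} = {Suc i}"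
    using i by auto
  moreover have "{j. j \<le> p + q \<and> (j = i \<and> i \<le> p \<or> i = j + 2 \<and> p \<le> j)} \<inter>
        {j. j \<le> p + q \<and> (j = i + 2 \<and> i + 2 \<le> p \<or> i + 2 = j + 2 \<and> p \<le> j)} = {}"
    using assms by auto
  ultimately have "gram (outer p i) (outer p (i + 2)) =
      w {outer p i, outer p (Suc i)} * w {outer p (i + 2), outer p (Suc i)}"
    unfolding gram_outer_outer[OF i] by simp
  moreover have "{outer p i, outer p (Suc i)} \<in> E" "{outer p (i + 2), outer p (Suc i)} \<in> E"
    using i by (simp_all add: outer_edge_iff)
  note this[THEN weight_sign]
  ultimately show ?thesis by auto
qed

lemma gram_inner_next:
  assumes "i + 2 \<le> p + q" "even i \<longleftrightarrow> even p"
  shows "gram (inner p i) (inner p (i + 2)) = 1 \<or> gram (inner p i) (inner p (i + 2)) = -1"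
proof -
  have i: "i \<le> p + q" "i + 2 \<le> p + q" using assms by auto
  have "{j. j \<le> p + q \<and> (j = Suc i \<or> i = Suc j)} \<inter>
        {j. j \<le> p + q \<and> (j = Suc (i + 2) \<or> i + 2 = Suc j)} = {Suc i}"
    using i by auto
  moreover have "{j. j \<le> p + q + 2 \<and> (j = i \<and> i \<le> p \<or> j = i + 2 \<and> p \<le> i)} \<inter>
        {j. j \<le> p + q + 2 \<and> (j = i + 2 \<and> i + 2 \<le> p \<or> j = i + 2 + 2 \<and> p \<le> i + 2)} = {}"
    using assms by auto
  ultimately have "gram (inner p i) (inner p (i + 2)) =
      w {inner p i, inner p (Suc i)} * w {inner p (i + 2), inner p (Suc i)}"
    unfolding gram_inner_inner[OF i] by simp
  moreover have "{inner p i, inner p (Suc i)} \<in> E" "{inner p (i + 2), inner p (Suc i)} \<in> E"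
    using i by (simp_all add: inner_edge_iff)
  note this[THEN weight_sign]
  ultimately show ?thesis by auto
qed

lemma gram_outer_far:
  assumes "i + 2 < j" "j \<le> p + q + 2" "even i \<longleftrightarrow> odd p" "even j \<longleftrightarrow> odd p"
  shows "gram (outer p i) (outer p j) = 0"
proof -
  have i: "i \<le> p + q + 2" using assms by auto
  have "{k. k \<le> p + q + 2 \<and> (k = Suc i \<or> i = Suc k)} \<inter>
        {k. k \<le> p + q + 2 \<and> (k = Suc j \<or> j = Suc k)} = {}"
    using assms by auto
  moreover have "{k. k \<le> p + q \<and> (k = i \<and> i \<le> p \<or> i = k + 2 \<and> p \<le> k)} \<inter>
        {k. k \<le> p + q \<and> (k = j \<and> j \<le> p \<or> j = k + 2 \<and> p \<le> k)} = {}"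
    using assms by auto
  ultimately show ?thesis unfolding gram_outer_outer[OF i assms(2)] by simp
qed

lemma gram_inner_far:
  assumes "i + 2 < j" "j \<le> p + q"
  shows "gram (inner p i) (inner p j) = 0"
proof -
  have i: "i \<le> p + q" using assms by auto
  have "{k. k \<le> p + q \<and> (k = Suc i \<or> i = Suc k)} \<inter>
        {k. k \<le> p + q \<and> (k = Suc j \<or> j = Suc k)} = {}"
    using assms by auto
  moreover have "{k. k \<le> p + q + 2 \<and> (k = i \<and> i \<le> p \<or> k = i + 2 \<and> p \<le> i)} \<inter>
        {k. k \<le> p + q + 2 \<and> (k = j \<and> j \<le> p \<or> k = j + 2 \<and> p \<le> j)} = {}"
    using assms by auto
  ultimately show ?thesis unfolding gram_inner_inner[OF i assms(2)] by simp
qed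

text \<open>The two paths of length two from \<open>a\<close> to \<open>c\<close> have weights 1 or
  -1 with product -1, hence opposite weights.\<close>

lemma tile_cancel:
  assumes "t \<in> set (L_snake (Suc p) (Suc q))"
    and "tile_edges t = {{a, b}, {b, c}, {d, c}, {a, d}}" "a \<noteq> c" "b \<noteq> d"
  shows "w {a, b} * w {c, b} + w {a, d} * w {c, d} = 0"
proof -
  \<comment> \<open>Edges are not loops, so the four listed edges are distinct and the product over
    the set has exactly four factors.\<close>
  have "card e = 2" if "e \<in> tile_edges t" for e
    using that by (cases t) auto
  then have "card {a, b} = 2" "card {b, c} = 2" "card {d, c} = 2" "card {a, d} = 2"
    using assms(2) by blast+
  then have ab: "a \<noteq> b" "b \<noteq> c" "d \<noteq> c" "a \<noteq> d" by auto
  have "w {a, b} * w {b, c} * w {d, c} * w {a, d} = -1"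
    using kasteleyn_weighting_tile[OF kasteleyn assms(1)] assms ab
    by (simp add: doubleton_eq_iff mult.assoc)
  moreover have "w e = 1 \<or> w e = -1" if "e \<in> tile_edges t" for e
    using weight_sign[of e] assms(1) that by (auto simp: snake_edges_def)
  then have "w {a, b} = 1 \<or> w {a, b} = -1" "w {b, c} = 1 \<or> w {b, c} = -1"
     "w {d, c} = 1 \<or> w {d, c} = -1" "w {a, d} = 1 \<or> w {a, d} = -1"
    using assms(2) by blast+
  ultimately show ?thesis by (auto simp: insert_commute)
qed

text \<open>The parities describe the colour of the outer corner. Such vertices are either opposite
  corners of a tile, where \<open>tile_cancel\<close> applies, or without common neighbours.\<close>

lemma gram_outer_inner_zero:
  assumes i: "i \<le> p + q + 2" and j: "j \<le> p + q"
    and parity: "even i \<longleftrightarrow> odd p" "even j \<longleftrightarrow> even p"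
  shows "gram (outer p i) (inner p j) = 0"
proof -
  let ?A = "{k. k \<le> p + q + 2 \<and> (k = Suc i \<or> i = Suc k)} \<inter>
        {k. k \<le> p + q + 2 \<and> (k = j \<and> j \<le> p \<or> k = j + 2 \<and> p \<le> j)}"
  let ?B = "{k. k \<le> p + q \<and> (k = i \<and> i \<le> p \<or> i = k + 2 \<and> p \<le> k)} \<inter>
        {k. k \<le> p + q \<and> (k = Suc j \<or> j = Suc k)}"
  have *: "gram (outer p i) (inner p j) =
      (\<Sum>k\<in>?A. w {outer p i, outer p k} * w {inner p j, outer p k}) +
      (\<Sum>k\<in>?B. w {outer p i, inner p k} * w {inner p j, inner p k})"
    by (rule gram_outer_inner[OF i j])
  consider (left) "i \<le> p" | (turn) "i = Suc p" | (right) "p + 2 \<le> i" by linarith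
  then show ?thesis
  proof cases
    case left
    consider (succ) "j = Suc i" | (prev) "i = Suc j" | (far) "j \<noteq> Suc i" "i \<noteq> Suc j" by blast
    then show ?thesis
    proof cases
      case succ
      \<comment> \<open>Parity excludes \<open>i = p\<close>, so the tile \<open>(i, 0)\<close> lies
        before the turning tile.\<close>
      then have "i < p" using left parity by (cases "i = p") auto
      with succ j have A: "?A = {Suc i}" and B: "?B = {i}" by auto
      have "w {outer p i, outer p (Suc i)} * w {inner p (Suc i), outer p (Suc i)} +
          w {outer p i, inner p i} * w {inner p (Suc i), inner p i} = 0"
        using \<open>i < p\<close> tile_edges_horizontal[of i p]
        by (intro tile_cancel[of "(i, 0)"]) (auto simp: set_L_snake insert_commute simp del: tile_edges.simps)
      then show ?thesis unfolding * A B by (simp add: succ)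
    next
      case prev
      with left j have A: "?A = {j}" and B: "?B = {Suc j}" by auto
      have "w {outer p (Suc j), outer p j} * w {inner p j, outer p j} +
          w {outer p (Suc j), inner p (Suc j)} * w {inner p j, inner p (Suc j)} = 0"
        using left prev tile_edges_horizontal[of j p]
        by (intro tile_cancel[of "(j, 0)"]) (auto simp: set_L_snake insert_commute simp del: tile_edges.simps)
      then show ?thesis unfolding * A B by (simp add: prev)
    next
      case far
      with left parity have A: "?A = {}" and B: "?B = {}" by auto
      show ?thesis unfolding * A B by simp
    qed
  next
    case turn
    show ?thesis
    proof (cases "j = p")
      case True
      \<comment> \<open>At the turning tile both intermediate vertices are on the outer
        line.\<close>
      with turn have A: "?A = {p, p + 2}" and B: "?B = {}" by auto
      have "w {outer p (Suc p), outer p p} * w {inner p p, outer p p} +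
          w {outer p (Suc p), outer p (p + 2)} * w {inner p p, outer p (p + 2)} = 0"
        using tile_edges_turning[of p]
        by (intro tile_cancel[of "(p, 0)"]) (auto simp: set_L_snake insert_commute simp del: tile_edges.simps)
      then show ?thesis unfolding * A B by (simp add: turn True)
    next
      case False
      with turn parity have A: "?A = {}" and B: "?B = {}" by auto
      show ?thesis unfolding * A B by simp
    qed
  next
    case right
    \<comment> \<open>Rungs now shift the index by two, so opposite corners of a tile have indices
      differing by one or by three.\<close>
    consider (prev) "i = Suc j" | (succ) "i = j + 3" "p \<le> j"
      | (far) "i \<noteq> Suc j" "\<not> (i = j + 3 \<and> p \<le> j)" by blast
    then show ?thesis
    proof cases
      case prev
      define k where "k = j - Suc p"
      have k: "i = p + k + 2" "j = Suc (p + k)" using prev right by (simp_all add: k_def)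
      have A: "?A = {Suc (p + k + 2)}" and B: "?B = {p + k}" using k j by auto
      have "w {outer p (p + k + 2), outer p (Suc (p + k + 2))} *
            w {inner p (Suc (p + k)), outer p (Suc (p + k + 2))} +
          w {outer p (p + k + 2), inner p (p + k)} * w {inner p (Suc (p + k)), inner p (p + k)} = 0"
        using tile_edges_vertical[of p k] k j
        by (intro tile_cancel[of "(p, Suc k)"]) (auto simp: set_L_snake insert_commute simp del: tile_edges.simps)
      then show ?thesis unfolding * A B by (simp add: k)
    next
      case succ
      define k where "k = j - p"
      have k: "i = Suc (p + k + 2)" "j = p + k" using succ by (simp_all add: k_def)
      have A: "?A = {p + k + 2}" and B: "?B = {Suc (p + k)}" using k i by auto
      have "w {outer p (Suc (p + k + 2)), outer p (p + k + 2)} *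
            w {inner p (p + k), outer p (p + k + 2)} +
          w {outer p (Suc (p + k + 2)), inner p (Suc (p + k))} *
            w {inner p (p + k), inner p (Suc (p + k))} = 0"
        using tile_edges_vertical[of p k] k i
        by (intro tile_cancel[of "(p, Suc k)"]) (auto simp: set_L_snake insert_commute simp del: tile_edges.simps)
      then show ?thesis unfolding * A B by (simp add: k)
    next
      case far
      \<comment> \<open>This excludes \<open>i = p + 2\<close> with \<open>j = p - 1\<close>, a pair
        that shares the neighbour \<open>inner p p\<close>.\<close>
      moreover have "p \<noteq> Suc j" using parity by auto
      ultimately have A: "?A = {}" and B: "?B = {}" using right parity by auto
      show ?thesis unfolding * A B by simp
    qed
  qed
qed

end

section \<open>The two paths of black vertices\<close>

text \<open>Locates vertices in a list of every second one along a line: \<open>a\<close> is the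
  index of the corner and \<open>b\<close> the distance after it; position \<open>a div 2\<close>
  holds the corner.\<close>

lemma double_plus_mod2_eq_iff:
  fixes a b k :: nat
  shows "2 * k + a mod 2 = a + b \<longleftrightarrow> k = a div 2 + b div 2 \<and> even b"
proof -
  define c d e where "c = a div 2" and "d = b div 2" and "e = a mod 2"
  then have a: "a = 2 * c + e" by simp
  have "2 * k + e = a + b \<longleftrightarrow> k = c + d \<and> even b"
  proof (cases "even b")
    case True
    then have "b = 2 * d" by (simp add: d_def)
    with a True show ?thesis by auto
  next
    case False
    then have "b = 2 * d + 1" by (simp add: d_def)
    with a have "2 * k + e = a + b \<longleftrightarrow> 2 * k = 2 * (c + d) + 1" by auto
    also have "\<dots> \<longleftrightarrow> False" by presburger
    finally show ?thesis using False by simp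
  qed
  then show ?thesis by (simp only: c_def d_def e_def)
qed

lemma double_plus_mod2_le_iff:
  fixes a b k :: nat
  shows "2 * k + a mod 2 \<le> a + b \<longleftrightarrow> k < a div 2 + Suc (b div 2)"
proof -
  have "a = 2 * (a div 2) + a mod 2" by simp
  moreover have "b = 2 * (b div 2) \<or> b = 2 * (b div 2) + 1" by presburger
  ultimately show ?thesis by linarith
qed

section \<open>The colour classes\<close>

lemma bipartition_vertices:
  assumes "bipartition ts Bl Wh"
  shows "snake_vertices ts = Bl \<union> Wh" and "Bl \<inter> Wh = {}"
  using assms by (simp_all add: bipartition_def)

lemma bipartition_edgeE:
  assumes "bipartition ts Bl Wh" "e \<in> snake_edges ts"
  obtains b u where "b \<in> Bl" "u \<in> Wh" "b \<notin> Wh" "u \<notin> Bl" "e = {b, u}"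
proof -
  from assms have "\<exists>b\<in>Bl. \<exists>u\<in>Wh. e = {b, u}" by (simp add: bipartition_def)
  then obtain b u where bu: "b \<in> Bl" "u \<in> Wh" "e = {b, u}" by (elim bexE)
  moreover note bipartition_vertices(2)[OF assms(1)]
  ultimately have "b \<notin> Wh" "u \<notin> Bl" by blast+
  with bu show ?thesis by (intro that)
qed

lemma bipartition_edge:
  assumes "bipartition ts Bl Wh" "{u, v} \<in> snake_edges ts"
  shows "u \<in> Bl \<longleftrightarrow> v \<notin> Bl"
  using assms by (rule bipartition_edgeE) (auto simp: doubleton_eq_iff)

lemma bipartition_swap:
  assumes "bipartition ts Bl Wh"
  shows "bipartition ts Wh Bl"
proof -
  have "\<exists>u\<in>Wh. \<exists>b\<in>Bl. e = {u, b}" if "e \<in> snake_edges ts" for e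
    using assms that by (rule bipartition_edgeE) (simp add: insert_commute, metis insert_commute)
  with assms show ?thesis
    by (simp add: bipartition_def Un_commute Int_commute)
qed

lemma bip_adj_matrix_transpose:
  "bip_adj_matrix ts w ws bs = (bip_adj_matrix ts w bs ws)\<^sup>T"
  by (rule eq_matI) (auto simp: bip_adj_matrix_def insert_commute)

text \<open>Colours alternate along the outer line and are fixed by the corner. A rung changes the
  colour but preserves the parity of the index, which settles the inner line.\<close>

lemma bipartition_L_snake_black:
  assumes "bipartition (L_snake (Suc p) (Suc q)) Bl Wh" "outer p (Suc p) \<in> Bl"
  shows "Bl = outer p ` {i. i \<le> p + q + 2 \<and> (even i \<longleftrightarrow> odd p)} \<union>
              inner p ` {i. i \<le> p + q \<and> (even i \<longleftrightarrow> even p)}"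
proof -
  note step = bipartition_edge[OF assms(1)]
  have outer: "outer p i \<in> Bl \<longleftrightarrow> (even i \<longleftrightarrow> outer p 0 \<in> Bl)" if "i \<le> p + q + 2" for i
    using that
  proof (induction i)
    case (Suc i)
    then show ?case using step[of "outer p i" "outer p (Suc i)"] by (auto simp: outer_edge_iff)
  qed simp
  have "outer p 0 \<in> Bl \<longleftrightarrow> odd p"
    using outer[of "Suc p"] assms(2) by auto
  then have outer': "outer p i \<in> Bl \<longleftrightarrow> (even i \<longleftrightarrow> odd p)" if "i \<le> p + q + 2" for i
    using outer[OF that] by simp
  have inner: "inner p i \<in> Bl \<longleftrightarrow> (even i \<longleftrightarrow> even p)" if "i \<le> p + q" for i
  proof (cases "i \<le> p")
    case True
    then show ?thesis
      using step[of "inner p i" "outer p i"] outer'[of i] that by (auto simp: inner_edge_iff)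
  next
    case False
    then show ?thesis
      using step[of "inner p i" "outer p (i + 2)"] outer'[of "i + 2"] that
      by (auto simp: inner_edge_iff)
  qed
  have "Bl \<subseteq> outer p ` {..p + q + 2} \<union> inner p ` {..p + q}"
    using bipartition_vertices(1)[OF assms(1)] unfolding snake_vertices_L_snake by simp
  then show ?thesis using outer' inner by auto
qed

section \<open>The characteristic polynomial as a product over the two lines\<close>

context L_weighting
begin

text \<open>Black indices on this line have the parity of the corner index \<open>Suc p\<close>;
  \<open>Suc p div 2\<close> of them precede the corner and \<open>Suc q div 2\<close> follow
  it.\<close>

definition outer_black :: "vertex list" where
  "outer_black = map (\<lambda>k. outer p (2 * k + Suc p mod 2)) [0..<Suc p div 2 + Suc (Suc q div 2)]"

definition inner_black :: "vertex list" where
  "inner_black = map (\<lambda>k. inner p (2 * k + p mod 2)) [0..<p div 2 + Suc (q div 2)]"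

text \<open>An entry of the characteristic matrix of BB^T, indexed by vertices so that lists of
  vertices can be reordered and split.\<close>

definition gram_char :: "vertex \<Rightarrow> vertex \<Rightarrow> real poly" where
  "gram_char b c = (if b = c then [:0, 1:] else 0) - [:gram b c:]"

lemma outer_black_index: "2 * k + Suc p mod 2 \<le> p + q + 2 \<longleftrightarrow> k < Suc p div 2 + Suc (Suc q div 2)"
  using double_plus_mod2_le_iff[of k "Suc p" "Suc q"] by simp

lemma inner_black_index: "2 * k + p mod 2 \<le> p + q \<longleftrightarrow> k < p div 2 + Suc (q div 2)"
  by (rule double_plus_mod2_le_iff)

lemma set_outer_black:
  "set outer_black = outer p ` {i. i \<le> p + q + 2 \<and> (even i \<longleftrightarrow> odd p)}"
proof -
  have "{i. i \<le> p + q + 2 \<and> (even i \<longleftrightarrow> odd p)} =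
      (\<lambda>k. 2 * k + Suc p mod 2) ` {k. 2 * k + Suc p mod 2 \<le> p + q + 2}"
  proof (intro equalityI subsetI)
    fix i assume i: "i \<in> {i. i \<le> p + q + 2 \<and> (even i \<longleftrightarrow> odd p)}"
    then have "i = 2 * (i div 2) + Suc p mod 2" by (auto simp: mod2_eq_if)
    with i show "i \<in> (\<lambda>k. 2 * k + Suc p mod 2) ` {k. 2 * k + Suc p mod 2 \<le> p + q + 2}"
      by (intro image_eqI[of _ _ "i div 2"]) auto
  qed (auto simp: mod2_eq_if split: if_splits)
  then show ?thesis
    by (simp only: outer_black_def set_map set_upt image_image outer_black_index atLeast0LessThan lessThan_def)
qed

lemma set_inner_black:
  "set inner_black = inner p ` {i. i \<le> p + q \<and> (even i \<longleftrightarrow> even p)}"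
proof -
  have "{i. i \<le> p + q \<and> (even i \<longleftrightarrow> even p)} =
      (\<lambda>k. 2 * k + p mod 2) ` {k. 2 * k + p mod 2 \<le> p + q}"
  proof (intro equalityI subsetI)
    fix i assume i: "i \<in> {i. i \<le> p + q \<and> (even i \<longleftrightarrow> even p)}"
    then have "i = 2 * (i div 2) + p mod 2" by (auto simp: mod2_eq_if)
    with i show "i \<in> (\<lambda>k. 2 * k + p mod 2) ` {k. 2 * k + p mod 2 \<le> p + q}"
      by (intro image_eqI[of _ _ "i div 2"]) auto
  qed (auto simp: mod2_eq_if split: if_splits)
  then show ?thesis
    by (simp only: inner_black_def set_map set_upt image_image inner_black_index atLeast0LessThan lessThan_def)
qed

text \<open>The corner has degree lowered by one, whence \<open>-1\<close>. The line starts with a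
  black vertex iff \<open>p\<close> is odd and ends with one iff \<open>q\<close> is odd.\<close>

lemma det_outer_black:
  "det (mat (length outer_black) (length outer_black)
      (\<lambda>(i, j). gram_char (outer_black ! i) (outer_black ! j))) =
   path_poly (two_arm_diag (-1) (odd p) (odd q) (Suc p div 2) (Suc q div 2))
     (Suc p div 2 + Suc (Suc q div 2))"
proof -
  define e where "e = Suc p mod 2"
  have e: "even (2 * k + e) \<longleftrightarrow> odd p" for k by (simp add: e_def mod2_eq_if)
  let ?N = "Suc p div 2 + Suc (Suc q div 2)"
  define f where "f i j = gram_char (outer p (2 * i + e)) (outer p (2 * j + e))" for i j
  have le: "2 * k + e \<le> p + q + 2" if "k < ?N" for k
    using that outer_black_index[of k] by (simp add: e_def)
  have "mat (length outer_black) (length outer_black)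
      (\<lambda>(i, j). gram_char (outer_black ! i) (outer_black ! j)) = mat ?N ?N (\<lambda>(i, j). f i j)"
    by (rule eq_matI) (auto simp: outer_black_def f_def e_def simp del: upt_Suc)
  also have "det \<dots> = path_poly (two_arm_diag (-1) (odd p) (odd q) (Suc p div 2) (Suc q div 2)) ?N"
  proof (rule det_path)
    fix i assume i: "i < ?N"
    have "2 * i + e = Suc p \<longleftrightarrow> i = Suc p div 2"
      using double_plus_mod2_eq_iff[of i "Suc p" 0] by (simp add: e_def)
    moreover have "2 * i + e = 0 \<longleftrightarrow> i = 0 \<and> odd p"
      by (auto simp: e_def mod2_eq_if)
    moreover have "2 * i + e = p + q + 2 \<longleftrightarrow> i = Suc p div 2 + Suc q div 2 \<and> odd q"
      using double_plus_mod2_eq_iff[of i "Suc p" "Suc q"] by (simp add: e_def)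
    ultimately show "f i i = [:- two_arm_diag (-1) (odd p) (odd q) (Suc p div 2) (Suc q div 2) i, 1:]"
      unfolding f_def gram_char_def gram_outer_self[OF le[OF i]] two_arm_diag_def by simp
  next
    fix i assume i: "Suc i < ?N"
    have 2: "2 * Suc i + e = 2 * i + e + 2" by simp
    have "2 * i + e \<le> p + q" using le[OF i] by simp
    \<comment> \<open>Opposite entries coincide by symmetry, so their product is the square of 1 or
      -1.\<close>
    from gram_outer_next[OF this e]
    show "f (Suc i) i * f i (Suc i) = 1"
      unfolding f_def gram_char_def 2 gram_commute[of "outer p (2 * i + e + 2)"]
      by (auto simp: one_pCons)
  next
    fix i j assume ij: "i < ?N" "j < ?N" "Suc i < j \<or> Suc j < i"
    have "gram (outer p (2 * i + e)) (outer p (2 * j + e)) = 0" if "Suc i < j" "j < ?N" for i j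
      using that le[of j] by (intro gram_outer_far e) auto
    then have "gram (outer p (2 * i + e)) (outer p (2 * j + e)) = 0"
      using ij gram_commute by metis
    then show "f i j = 0" using ij(3) by (auto simp: f_def gram_char_def)
  qed
  finally show ?thesis .
qed

text \<open>Here the corner index is \<open>p\<close> and its degree is raised by one; the ends are
  black for even \<open>p\<close> and even \<open>q\<close> respectively.\<close>

lemma det_inner_black:
  "det (mat (length inner_black) (length inner_black)
      (\<lambda>(i, j). gram_char (inner_black ! i) (inner_black ! j))) =
   path_poly (two_arm_diag 1 (even p) (even q) (p div 2) (q div 2)) (p div 2 + Suc (q div 2))"
proof -
  define e where "e = p mod 2"
  have e: "even (2 * k + e) \<longleftrightarrow> even p" for k by (simp add: e_def mod2_eq_if)
  let ?N = "p div 2 + Suc (q div 2)"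
  define f where "f i j = gram_char (inner p (2 * i + e)) (inner p (2 * j + e))" for i j
  have le: "2 * k + e \<le> p + q" if "k < ?N" for k
    using that inner_black_index[of k] by (simp add: e_def)
  have "mat (length inner_black) (length inner_black)
      (\<lambda>(i, j). gram_char (inner_black ! i) (inner_black ! j)) = mat ?N ?N (\<lambda>(i, j). f i j)"
    by (rule eq_matI) (auto simp: inner_black_def f_def e_def simp del: upt_Suc)
  also have "det \<dots> = path_poly (two_arm_diag 1 (even p) (even q) (p div 2) (q div 2)) ?N"
  proof (rule det_path)
    fix i assume i: "i < ?N"
    have "2 * i + e = p \<longleftrightarrow> i = p div 2"
      using double_plus_mod2_eq_iff[of i p 0] by (simp add: e_def)
    moreover have "2 * i + e = 0 \<longleftrightarrow> i = 0 \<and> even p"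
      by (auto simp: e_def mod2_eq_if)
    moreover have "2 * i + e = p + q \<longleftrightarrow> i = p div 2 + q div 2 \<and> even q"
      unfolding e_def by (rule double_plus_mod2_eq_iff)
    ultimately show "f i i = [:- two_arm_diag 1 (even p) (even q) (p div 2) (q div 2) i, 1:]"
      unfolding f_def gram_char_def gram_inner_self[OF le[OF i]] two_arm_diag_def by simp
  next
    fix i assume i: "Suc i < ?N"
    have 2: "2 * Suc i + e = 2 * i + e + 2" by simp
    have "2 * i + e + 2 \<le> p + q" using le[OF i] by simp
    from gram_inner_next[OF this e]
    show "f (Suc i) i * f i (Suc i) = 1"
      unfolding f_def gram_char_def 2 gram_commute[of "inner p (2 * i + e + 2)"]
      by (auto simp: one_pCons)
  next
    fix i j assume ij: "i < ?N" "j < ?N" "Suc i < j \<or> Suc j < i"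
    have "gram (inner p (2 * i + e)) (inner p (2 * j + e)) = 0" if "Suc i < j" "j < ?N" for i j
      using that le[of j] by (intro gram_inner_far) auto
    then have "gram (inner p (2 * i + e)) (inner p (2 * j + e)) = 0"
      using ij gram_commute by metis
    then show "f i j = 0" using ij(3) by (auto simp: f_def gram_char_def)
  qed
  finally show ?thesis .
qed

text \<open>Besides the factorisation, the lengths are recorded: \<open>B\<close> is square, as
  needed for exchanging it with its transpose.\<close>

lemma chi_outer_corner_black:
  assumes bip: "bipartition (L_snake (Suc p) (Suc q)) (set bs) (set ws)"
    and dist: "distinct bs" "distinct ws" and corner: "outer p (Suc p) \<in> set bs"
  shows "chi (bip_adj_matrix (L_snake (Suc p) (Suc q)) w bs ws) =
     path_poly (two_arm_diag (-1) (odd p) (odd q) (Suc p div 2) (Suc q div 2))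
       (Suc p div 2 + Suc (Suc q div 2)) *
     path_poly (two_arm_diag 1 (even p) (even q) (p div 2) (q div 2)) (p div 2 + Suc (q div 2))"
    and "length bs = p + q + 2" and "length ws = p + q + 2"
proof -
  let ?B = "bip_adj_matrix (L_snake (Suc p) (Suc q)) w bs ws"
  let ?cs = "outer_black @ inner_black"
  have set: "set bs = set ?cs"
    using bipartition_L_snake_black[OF bip corner] by (simp add: set_outer_black set_inner_black)
  have dist': "distinct ?cs"
    unfolding distinct_append set_outer_black set_inner_black
    by (auto simp: outer_black_def inner_black_def distinct_map inj_on_def)
  show len: "length bs = p + q + 2"
  proof -
    have "length bs = length ?cs"
      using set dist(1) dist' by (metis distinct_card)
    also have "\<dots> = (Suc p div 2 + p div 2) + (Suc q div 2 + q div 2) + 2"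
      by (simp add: outer_black_def inner_black_def del: upt_Suc)
    also have "Suc p div 2 + p div 2 = p" by presburger
    also have "Suc q div 2 + q div 2 = q" by presburger
    finally show ?thesis .
  qed
  note VU = bipartition_vertices(1)[OF bip] and disj = bipartition_vertices(2)[OF bip]
  have "card V = (p + q + 3) + (p + q + 1)"
    unfolding snake_vertices_L_snake
    by (subst card_Un_disjoint) (auto simp: card_image inj_on_def)
  then show "length ws = p + q + 2"
    using len disj dist unfolding VU by (simp add: card_Un_disjoint distinct_card)
  have prod: "(?B * ?B\<^sup>T) $$ (i, j) = gram (bs ! i) (bs ! j)"
    if "i < length bs" "j < length bs" for i j
  proof -
    have "(?B * ?B\<^sup>T) $$ (i, j) = (\<Sum>k<length ws. weight (bs ! i) (ws ! k) * weight (bs ! j) (ws ! k))"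
      using that by (simp add: bip_adj_matrix_def scalar_prod_def weight_def atLeast0LessThan)
    also have "\<dots> = (\<Sum>u\<in>set ws. weight (bs ! i) u * weight (bs ! j) u)"
      using bij_betw_nth[OF dist(2) refl refl] by (rule sum.reindex_bij_betw)
    also have "\<dots> = gram (bs ! i) (bs ! j)"
      unfolding gram_def
    proof (rule sum.mono_neutral_left)
      \<comment> \<open>The remaining vertices are black, and no edge joins two black
        vertices.\<close>
      show "\<forall>u\<in>V - set ws. weight (bs ! i) u * weight (bs ! j) u = 0"
        using bipartition_edge[OF bip, of "bs ! i"] that VU by (auto simp: weight_def)
    qed (auto simp: VU finite_snake_vertices)
    finally show ?thesis .
  qed
  have "char_poly_matrix (?B * ?B\<^sup>T) =
      mat (length bs) (length bs) (\<lambda>(i, j). gram_char (bs ! i) (bs ! j))"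
  proof (rule eq_matI)
    fix i j
    assume "i < dim_row (mat (length bs) (length bs) (\<lambda>(i, j). gram_char (bs ! i) (bs ! j)))"
      "j < dim_col (mat (length bs) (length bs) (\<lambda>(i, j). gram_char (bs ! i) (bs ! j)))"
    then have ij: "i < length bs" "j < length bs" by simp_all
    moreover have "dim_row ?B = length bs" by (simp add: bip_adj_matrix_def)
    ultimately show "char_poly_matrix (?B * ?B\<^sup>T) $$ (i, j) =
        mat (length bs) (length bs) (\<lambda>(i, j). gram_char (bs ! i) (bs ! j)) $$ (i, j)"
      using prod[OF ij] dist(1)
      by (simp add: char_poly_matrix_def gram_char_def nth_eq_iff_index_eq del: index_mult_mat(1))
  qed (simp_all add: char_poly_matrix_def bip_adj_matrix_def)
  then have "chi ?B = det (mat (length bs) (length bs) (\<lambda>(i, j). gram_char (bs ! i) (bs ! j)))"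
    by (simp add: chi_def char_poly_def)
  also have "\<dots> = det (mat (length ?cs) (length ?cs) (\<lambda>(i, j). gram_char (?cs ! i) (?cs ! j)))"
    by (rule det_map_list_perm[OF dist(1) dist' set])
  also have "\<dots> = det (mat (length outer_black) (length outer_black)
        (\<lambda>(i, j). gram_char (outer_black ! i) (outer_black ! j))) *
      det (mat (length inner_black) (length inner_black)
        (\<lambda>(i, j). gram_char (inner_black ! i) (inner_black ! j)))"
  proof (rule det_append_list)
    fix u v assume "u \<in> set outer_black" "v \<in> set inner_black"
    then obtain i j where "u = outer p i" "v = inner p j" "i \<le> p + q + 2" "j \<le> p + q"
      "even i \<longleftrightarrow> odd p" "even j \<longleftrightarrow> even p"
      unfolding set_outer_black set_inner_black by blast
    then show "gram_char u v = 0" "gram_char v u = 0"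
      using gram_outer_inner_zero[of i j] gram_commute[of v u] by (simp_all add: gram_char_def)
  qed
  finally show "chi ?B =
     path_poly (two_arm_diag (-1) (odd p) (odd q) (Suc p div 2) (Suc q div 2))
       (Suc p div 2 + Suc (Suc q div 2)) *
     path_poly (two_arm_diag 1 (even p) (even q) (p div 2) (q div 2)) (p div 2 + Suc (q div 2))"
    unfolding det_outer_black det_inner_black .
qed

end

text \<open>On a straight snake the colouring may make the outer corner white, so both possibilities
  are treated.\<close>

lemma chi_L_snake:
  assumes "L_bip_adj (Suc p) (Suc q) B"
  shows "chi B =
     path_poly (two_arm_diag (-1) (odd p) (odd q) (Suc p div 2) (Suc q div 2))
       (Suc p div 2 + Suc (Suc q div 2)) *
     path_poly (two_arm_diag 1 (even p) (even q) (p div 2) (q div 2)) (p div 2 + Suc (q div 2))"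
proof -
  obtain w bs ws where w: "kasteleyn_weighting (L_snake (Suc p) (Suc q)) w"
    and dist: "distinct bs" "distinct ws"
    and col: "L_colouring (Suc p) (Suc q) (set bs) (set ws)"
    and B: "B = bip_adj_matrix (L_snake (Suc p) (Suc q)) w bs ws"
    using assms unfolding L_bip_adj_def by blast
  interpret L_weighting p q w by unfold_locales (rule w)
  from col have bip: "bipartition (L_snake (Suc p) (Suc q)) (set bs) (set ws)"
    unfolding L_colouring_def by blast
  show ?thesis
  proof (cases "outer p (Suc p) \<in> set bs")
    case True
    show ?thesis unfolding B by (rule chi_outer_corner_black[OF bip dist True])
  next
    case False
    have "outer p (Suc p) \<in> V" by (simp add: snake_vertices_L_snake)
    with False have corner: "outer p (Suc p) \<in> set ws"
      unfolding bipartition_vertices(1)[OF bip] by simp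
    note swapped = chi_outer_corner_black[OF bipartition_swap[OF bip] dist(2,1) corner]
    have "B \<in> carrier_mat (p + q + 2) (p + q + 2)"
      unfolding B using swapped(2,3) by (simp add: bip_adj_matrix_def)
    then have "chi B = chi (B\<^sup>T)"
      unfolding chi_def using char_poly_mult_commute[of B "p + q + 2" "B\<^sup>T"] by simp
    also have "B\<^sup>T = bip_adj_matrix (L_snake (Suc p) (Suc q)) w ws bs"
      unfolding B by (rule bip_adj_matrix_transpose[symmetric])
    finally show ?thesis unfolding swapped(1) .
  qed
qed

text \<open>With \<open>p\<close> and \<open>q\<close> one less than the snake parameters, their
  parities determine the flags in \<open>path_poly_two_arm\<close>. In each formula the first factor
  comes from the inner line and the second from the outer line.\<close>

theorem theorem5p5:
  fixes m n :: nat
  shows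
    "(1 \<le> m \<longrightarrow> 1 \<le> n \<longrightarrow> (\<forall>B. L_bip_adj (2 * m) (2 * n) B \<longrightarrow>
        chi B = (fibQ (m + n - 1) - fibQ (m - 1) * fibQ (n - 1)) *
                ([:-1, 1:] * fibQ (m + n) + fibP m * fibP n))) \<and>
     (\<forall>B. L_bip_adj (2 * m + 1) (2 * n + 1) B \<longrightarrow>
        chi B = ([:-1, 1:] * fibQ (m + n) - fibP m * fibP n) *
                (fibQ (m + n + 1) + fibQ m * fibQ n)) \<and>
     (1 \<le> m \<longrightarrow> (\<forall>B. L_bip_adj (2 * m) (2 * n + 1) B \<longrightarrow>
        chi B = (fibP (m + n) - fibQ (m - 1) * fibP n) *
                (fibP (m + n + 1) + fibP m * fibQ n)))"
proof (intro conjI impI allI)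
  fix B assume "1 \<le> m" "1 \<le> n" and B: "L_bip_adj (2 * m) (2 * n) B"
  then obtain k l where m: "m = Suc k" and n: "n = Suc l"
    by (metis One_nat_def Suc_le_D)
  \<comment> \<open>Here \<open>p = 2 * k + 1\<close>, so the turn has position \<open>m\<close>
    among the black outer vertices but \<open>m - 1\<close> among the inner ones.\<close>
  have eq: "2 * m = Suc (2 * k + 1)" "2 * n = Suc (2 * l + 1)" by (simp_all add: m n)
  have div: "Suc (2 * k + 1) div 2 = Suc k" "Suc (2 * l + 1) div 2 = Suc l"
     "(2 * k + 1) div 2 = k" "(2 * l + 1) div 2 = l" by simp_all
  have odd: "odd (2 * k + 1)" "odd (2 * l + 1)" by simp_all
  show "chi B = (fibQ (m + n - 1) - fibQ (m - 1) * fibQ (n - 1)) *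
                ([:-1, 1:] * fibQ (m + n) + fibP m * fibP n)"
    unfolding chi_L_snake[OF B[unfolded eq]] div
    using odd path_poly_two_arm(4)[of "-1" "Suc k" "Suc l"] path_poly_two_arm(1)[of 1 k l]
    by (simp add: m n mult.commute del: fibP_simps fibQ_simps path_poly.simps)
next
  fix B assume B: "L_bip_adj (2 * m + 1) (2 * n + 1) B"
  have eq: "2 * m + 1 = Suc (2 * m)" "2 * n + 1 = Suc (2 * n)" by simp_all
  have div: "Suc (2 * m) div 2 = m" "Suc (2 * n) div 2 = n"
     "2 * m div 2 = m" "2 * n div 2 = n" by simp_all
  have even: "even (2 * m)" "even (2 * n)" by simp_all
  show "chi B = ([:-1, 1:] * fibQ (m + n) - fibP m * fibP n) *
                (fibQ (m + n + 1) + fibQ m * fibQ n)"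
    unfolding chi_L_snake[OF B[unfolded eq]] div
    using even path_poly_two_arm(1)[of "-1" m n] path_poly_two_arm(4)[of 1 m n]
    by (simp add: mult.commute del: fibP_simps fibQ_simps path_poly.simps)
next
  fix B assume "1 \<le> m" and B: "L_bip_adj (2 * m) (2 * n + 1) B"
  then obtain k where m: "m = Suc k"
    by (metis One_nat_def Suc_le_D)
  have eq: "2 * m = Suc (2 * k + 1)" "2 * n + 1 = Suc (2 * n)" by (simp_all add: m)
  have div: "Suc (2 * k + 1) div 2 = Suc k" "Suc (2 * n) div 2 = n"
     "(2 * k + 1) div 2 = k" "2 * n div 2 = n" by simp_all
  have parity: "odd (2 * k + 1)" "even (2 * n)" by simp_all
  show "chi B = (fibP (m + n) - fibQ (m - 1) * fibP n) *
                (fibP (m + n + 1) + fibP m * fibQ n)"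
    unfolding chi_L_snake[OF B[unfolded eq]] div
    using parity path_poly_two_arm(2)[of "-1" "Suc k" n] path_poly_two_arm(3)[of 1 k n]
    by (simp add: m mult.commute del: fibP_simps fibQ_simps path_poly.simps)
qed

end
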